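(* Let $A\in\mathbb{R}^{n\times n}$, $B\in\mathbb{R}^{n\times r}$, $H\in\mathbb{R}^{p\times n}$, and let $\mathcal{H}_*\subset\mathbb{R}^n_*$ be the span of the rows of $H$. Let $W\subset\mathbb{R}^n$ be the largest $(A,B)$-invariant subspace contained in $\mathcal{H}_*^{\perp}=\ker H$. Then the $(A,B)$-invariant closure of $\mathcal{H}_*$ is $\overline{\mathcal{H}}_*^{(A,B)}=W^{\perp}$; that is, $W^\perp$ is the smallest $(A,B)$-invariant dual subspace of $\mathbb{R}^n_*$ containing $\mathcal{H}_*$.
   Context: $\mathbb{R}^n_*$ is the dual space of $\mathbb{R}^n$, identified with row vectors of length $n$; a dual subspace is a linear subspace of $\mathbb{R}^n_*$. A dual subspace $\mathcal{V}_*$ is $(A,B)$-invariant if there exists $F\in\mathbb{R}^{r\times n}$ with $\mathcal{V}_*(A+BF)\subset\mathcal{V}_*$. A subspace $\mathcal{V}\subset\mathbb{R}^n$ is $(A,B)$-invariant if there exists $F\in\mathbb{R}^{r\times n}$ with $(A+BF)\mathcal{V}\subset\mathcal{V}$. It is a classical fact that among the $(A,B)$-invariant subspaces contained in a given subspace there is a unique largest one. For a subspace $W\subset\mathbb{R}^n$, $W^\perp:=\{h\in\mathbb{R}^n_*: hx=0\ \text{for all } x\in W\}$; for a dual subspace $\mathcal{H}_*$, $\mathcal{H}_*^\perp:=\{x\in\mathbb{R}^n: hx=0\ \text{for all } h\in\mathcal{H}_*\}$. The $(A,B)$-invariant closure $\overline{\mathcal{H}}_*^{(A,B)}$ is the smallest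 (with respect to inclusion) $(A,B)$-invariant dual subspace containing $\mathcal{H}_*$. *)

theory Defs
  imports "HOL-Analysis.Analysis"
begin

text \<open>
  Column vectors and row vectors (elements of the dual space) of length \<open>n\<close> are both
  represented by the type \<open>real^'n\<close>. A row vector \<open>h\<close> acts on matrices from the left by
  \<open>h v* M\<close>, and \<open>h \<bullet> x\<close> is the matrix product \<open>hx\<close>.
\<close>

definition invariant_subspace ::
    "real^'n^'n \<Rightarrow> real^'r^'n \<Rightarrow> (real^'n) set \<Rightarrow> bool" where
  "invariant_subspace A B V \<longleftrightarrow>
     subspace V \<and> (\<exists>F :: real^'n^'r. (\<lambda>x. (A + B ** F) *v x) ` V \<subseteq> V)"

definition invariant_dual_subspace ::
    "real^'n^'n \<Rightarrow> real^'r^'n \<Rightarrow> (real^'n) set \<Rightarrow> bool" where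
  "invariant_dual_subspace A B V \<longleftrightarrow>
     subspace V \<and> (\<exists>F :: real^'n^'r. (\<lambda>h. h v* (A + B ** F)) ` V \<subseteq> V)"

definition annihilator :: "(real^'n) set \<Rightarrow> (real^'n) set" where
  "annihilator W = {h. \<forall>x\<in>W. h \<bullet> x = 0}"

definition dual_annihilator :: "(real^'n) set \<Rightarrow> (real^'n) set" where
  "dual_annihilator V = {x. \<forall>h\<in>V. h \<bullet> x = 0}"

text \<open>
  \<open>GREATEST\<close> and \<open>LEAST\<close> refer to inclusion of sets; they are unspecified when no
  greatest (least) such set exists.
\<close>

definition largest_invariant_subspace ::
    "real^'n^'n \<Rightarrow> real^'r^'n \<Rightarrow> (real^'n) set \<Rightarrow> (real^'n) set" where
  "largest_invariant_subspace A B S = (GREATEST V. invariant_subspace A B V \<and> V \<subseteq> S)"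

definition invariant_closure ::
    "real^'n^'n \<Rightarrow> real^'r^'n \<Rightarrow> (real^'n) set \<Rightarrow> (real^'n) set" where
  "invariant_closure A B S = (LEAST V. invariant_dual_subspace A B V \<and> S \<subseteq> V)"

end

theory Submission
  imports Defs
begin

text \<open>
  The identity \<open>(h M) x = h (M x)\<close> shows that \<open>V\<^sup>\<bottom>\<close> is invariant as soon as \<open>V\<close> is, with the same
  feedback \<open>F\<close>, in both directions between subspaces and dual subspaces. As \<open>V\<^sup>\<bottom>\<^sup>\<bottom> = V\<close>,
  annihilators reverse inclusions and exchange largest invariant subspaces with smallest
  invariant dual subspaces. The largest invariant subspace exists because invariance amounts to
  \<open>A V \<subseteq> V + im B\<close>, a condition that no longer mentions \<open>F\<close> and is inherited by the span of a union.
\<close>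

text \<open>Rows and columns share one type and pair by the inner product, so both annihilators
  become the orthogonal complement, whose double-complement law serves later.\<close>

lemma annihilator_eq_orthogonal_comp: "annihilator W = orthogonal_comp W"
  by (auto simp: annihilator_def orthogonal_comp_def orthogonal_def inner_commute)

lemma dual_annihilator_eq_orthogonal_comp: "dual_annihilator V = orthogonal_comp V"
  by (auto simp: dual_annihilator_def orthogonal_comp_def orthogonal_def)

lemma invariant_dual_subspace_annihilator:
  assumes "invariant_subspace A B V"
  shows "invariant_dual_subspace A B (annihilator V)"
proof -
  obtain F where F: "(\<lambda>x. (A + B ** F) *v x) ` V \<subseteq> V"
    using assms by (auto simp: invariant_subspace_def)
  have "(\<lambda>h. h v* (A + B ** F)) ` annihilator V \<subseteq> annihilator V"
    using F by (auto simp: annihilator_def dot_lmul_matrix)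
  then show ?thesis
    unfolding invariant_dual_subspace_def
    by (auto simp: annihilator_eq_orthogonal_comp subspace_orthogonal_comp)
qed

lemma invariant_subspace_dual_annihilator:
  assumes "invariant_dual_subspace A B V"
  shows "invariant_subspace A B (dual_annihilator V)"
proof -
  obtain F where F: "(\<lambda>h. h v* (A + B ** F)) ` V \<subseteq> V"
    using assms by (auto simp: invariant_dual_subspace_def)
  have "(\<lambda>x. (A + B ** F) *v x) ` dual_annihilator V \<subseteq> dual_annihilator V"
    using F by (auto simp: dual_annihilator_def dot_lmul_matrix[symmetric])
  then show ?thesis
    unfolding invariant_subspace_def
    by (auto simp: dual_annihilator_eq_orthogonal_comp subspace_orthogonal_comp)
qed

text \<open>A feedback \<open>F\<close> supplies the control \<open>u = F *v x\<close>. Conversely,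
  controls picked on a basis of \<open>V\<close> extend linearly to a feedback.\<close>

lemma invariant_subspace_iff:
  fixes A :: "real^'n^'n" and B :: "real^'r^'n"
  shows "invariant_subspace A B V \<longleftrightarrow> subspace V \<and> (\<forall>x\<in>V. \<exists>u. A *v x + B *v u \<in> V)"
proof
  assume "invariant_subspace A B V"
  then obtain F where "subspace V" and F: "\<And>x. x \<in> V \<Longrightarrow> (A + B ** F) *v x \<in> V"
    by (auto simp: invariant_subspace_def)
  have "A *v x + B *v (F *v x) \<in> V" if "x \<in> V" for x
    using F[OF that] by (simp add: matrix_vector_mult_add_rdistrib matrix_vector_mul_assoc)
  then show "subspace V \<and> (\<forall>x\<in>V. \<exists>u. A *v x + B *v u \<in> V)"
    using \<open>subspace V\<close> by blast
next
  assume V: "subspace V \<and> (\<forall>x\<in>V. \<exists>u. A *v x + B *v u \<in> V)"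
  then have "\<exists>f. \<forall>x\<in>V. A *v x + B *v f x \<in> V"
    by (intro bchoice) (rule conjunct2)
  then obtain f where f: "\<And>x. x \<in> V \<Longrightarrow> A *v x + B *v f x \<in> V"
    by blast
  obtain b where b: "b \<subseteq> V" "independent b" "V \<subseteq> span b"
    by (rule basis_exists)
  \<comment> \<open>The choice function \<open>f\<close> need not be linear, so only its values on
    the basis \<open>b\<close> are kept; the matrix of \<open>g\<close> is the feedback.\<close>
  obtain g where g: "linear g" "\<And>x. x \<in> b \<Longrightarrow> g x = f x"
    using linear_independent_extend[OF b(2), of f] by blast
  let ?M = "A + B ** matrix g"
  have M: "?M *v x = A *v x + B *v g x" for x
    by (simp add: matrix_vector_mult_add_rdistrib matrix_vector_mul_assoc[symmetric]
        matrix_vector_mul(2)[OF g(1)])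
  \<comment> \<open>The vectors sent into \<open>V\<close> form a subspace, so checking the basis,
    where \<open>g\<close> agrees with \<open>f\<close>, is enough.\<close>
  have "subspace {x. ?M *v x \<in> V}"
    using V linear_subspace_vimage[OF matrix_vector_mul_linear[of ?M], of V]
    by (simp add: vimage_def)
  moreover have "b \<subseteq> {x. ?M *v x \<in> V}"
    using f g(2) b(1) by (auto simp: M)
  ultimately have "V \<subseteq> {x. ?M *v x \<in> V}"
    using b(3) span_minimal by blast
  then show "invariant_subspace A B V"
    using V by (auto simp: invariant_subspace_def)
qed

text \<open>Different members may need different feedbacks, but controls combine linearly: if
  \<open>v\<close> serves \<open>x\<close> and \<open>u\<close> serves \<open>y\<close>, then
  \<open>c *\<^sub>R v + u\<close> serves \<open>c *\<^sub>R x + y\<close>.\<close>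

lemma invariant_subspace_span_Union:
  fixes A :: "real^'n^'n" and B :: "real^'r^'n"
  assumes "\<And>V. V \<in> \<V> \<Longrightarrow> invariant_subspace A B V"
  shows "invariant_subspace A B (span (\<Union>\<V>))"
proof -
  let ?S = "span (\<Union>\<V>)"
  have "\<exists>u. A *v x + B *v u \<in> ?S" if "x \<in> ?S" for x
    using that
  proof (induction rule: span_induct_alt)
    case base
    have "A *v 0 + B *v 0 \<in> ?S"
      by (simp add: span_zero)
    then show ?case ..
  next
    case (step c x y)
    obtain u where u: "A *v y + B *v u \<in> ?S"
      using step by blast
    obtain V where V: "V \<in> \<V>" "x \<in> V"
      using step by blast
    then obtain v where "A *v x + B *v v \<in> V"
      using assms[OF V(1)] by (auto simp: invariant_subspace_iff)
    then have "A *v x + B *v v \<in> ?S"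
      using V(1) by (blast intro: span_base)
    then have "c *\<^sub>R (A *v x + B *v v) + (A *v y + B *v u) \<in> ?S"
      using u by (metis span_add span_scale)
    then have "A *v (c *\<^sub>R x + y) + B *v (c *\<^sub>R v + u) \<in> ?S"
      by (simp add: matrix_vector_right_distrib matrix_vector_mult_scaleR algebra_simps)
    then show ?case ..
  qed
  then show ?thesis
    by (simp add: invariant_subspace_iff)
qed

text \<open>The span of the union of all invariant subspaces inside \<open>S\<close> is itself one
  of them and contains the others, so the \<open>GREATEST\<close> in the definition is
  attained.\<close>

lemma
  assumes S: "subspace S"
  shows invariant_subspace_largest_invariant_subspace:
      "invariant_subspace A B (largest_invariant_subspace A B S)" (is ?inv)
    and largest_invariant_subspace_subset: "largest_invariant_subspace A B S \<subseteq> S" (is ?sub)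
    and largest_invariant_subspace_greatest:
      "\<And>V. invariant_subspace A B V \<Longrightarrow> V \<subseteq> S \<Longrightarrow> V \<subseteq> largest_invariant_subspace A B S"
proof -
  let ?\<V> = "{V. invariant_subspace A B V \<and> V \<subseteq> S}"
  have inv: "invariant_subspace A B (span (\<Union>?\<V>))"
    by (rule invariant_subspace_span_Union) simp
  have sub: "span (\<Union>?\<V>) \<subseteq> S"
    using S by (intro span_minimal) auto
  have ge: "V \<subseteq> span (\<Union>?\<V>)" if "invariant_subspace A B V" "V \<subseteq> S" for V
    using that by (auto intro: span_base)
  have eq: "largest_invariant_subspace A B S = span (\<Union>?\<V>)"
    unfolding largest_invariant_subspace_def
    by (rule Greatest_equality) (use inv sub ge in auto)
  show ?inv ?sub
    unfolding eq by (fact inv sub)+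
  show "V \<subseteq> largest_invariant_subspace A B S" if "invariant_subspace A B V" "V \<subseteq> S" for V
    unfolding eq using that by (rule ge)
qed

lemma dual_annihilator_span_rows:
  fixes H :: "real^'n^'p"
  shows "dual_annihilator (span (rows H)) = {x. H *v x = 0}"
proof -
  have "dual_annihilator (span (rows H)) = {x. \<forall>h\<in>rows H. h \<bullet> x = 0}"
  proof (intro equalityI subsetI)
    fix x assume x: "x \<in> {x. \<forall>h\<in>rows H. h \<bullet> x = 0}"
    \<comment> \<open>For fixed \<open>x\<close>, the row vectors that kill \<open>x\<close> form a
      subspace, so vanishing on the rows of \<open>H\<close> passes to their span.\<close>
    have "span (rows H) \<subseteq> {h. x \<bullet> h = 0}"
      by (rule span_minimal[OF _ subspace_hyperplane]) (use x in \<open>auto simp: inner_commute\<close>)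
    then show "x \<in> dual_annihilator (span (rows H))"
      by (auto simp: dual_annihilator_def inner_commute)
  qed (auto simp: dual_annihilator_def span_base)
  also have "\<dots> = {x. H *v x = 0}"
    by (auto simp: rows_def row_def vec_eq_iff matrix_vector_mult_def inner_vec_def)
  finally show ?thesis .
qed

theorem mainTheorem5:
  fixes A :: "real^'n^'n" and B :: "real^'r^'n" and H :: "real^'n^'p"
    and Hs W :: "(real^'n) set"
  assumes Hs: "Hs = span (rows H)"
    and W: "W = largest_invariant_subspace A B (dual_annihilator Hs)"
  shows "dual_annihilator Hs = {x. H *v x = 0} \<and>
    invariant_closure A B Hs = annihilator W \<and>
    invariant_dual_subspace A B (annihilator W) \<and>
    Hs \<subseteq> annihilator W \<and>
    (\<forall>V. invariant_dual_subspace A B V \<and> Hs \<subseteq> V \<longrightarrow> annihilator W \<subseteq> V)"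
proof -
  have S: "subspace (dual_annihilator Hs)"
    by (simp add: dual_annihilator_eq_orthogonal_comp subspace_orthogonal_comp)
  have inv: "invariant_dual_subspace A B (annihilator W)"
    unfolding W by (intro invariant_dual_subspace_annihilator
        invariant_subspace_largest_invariant_subspace S)
  have sub: "Hs \<subseteq> annihilator W"
    using largest_invariant_subspace_subset[OF S, of A B]
    by (auto simp: W annihilator_def dual_annihilator_def)
  have least: "annihilator W \<subseteq> V" if V: "invariant_dual_subspace A B V" "Hs \<subseteq> V" for V
  proof -
    \<comment> \<open>The annihilator of a competitor \<open>V\<close> is an invariant subspace
      inside that of \<open>Hs\<close>, hence lies in \<open>W\<close>; annihilating once more
      reverses the inclusion.\<close>
    have "dual_annihilator V \<subseteq> dual_annihilator Hs"
      using V(2) by (auto simp: dual_annihilator_def)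
    then have "dual_annihilator V \<subseteq> W"
      unfolding W by (intro largest_invariant_subspace_greatest S
          invariant_subspace_dual_annihilator V(1))
    then have "annihilator W \<subseteq> annihilator (dual_annihilator V)"
      by (auto simp: annihilator_def)
    \<comment> \<open>In finite dimension a subspace equals its double orthogonal
      complement.\<close>
    also have "\<dots> = V"
      using V(1) by (simp add: annihilator_eq_orthogonal_comp dual_annihilator_eq_orthogonal_comp
          orthogonal_comp_self invariant_dual_subspace_def)
    finally show ?thesis .
  qed
  have "invariant_closure A B Hs = annihilator W"
    unfolding invariant_closure_def by (rule Least_equality) (use inv sub least in auto)
  then show ?thesis
    using inv sub least by (simp add: Hs dual_annihilator_span_rows)
qed

end
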